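(* There exists no 3-dimensional essentially conformally symmetric gradient $\rho$-Einstein soliton; that is, if $(M,g)$ is a 3-dimensional essentially conformally symmetric pseudo-Riemannian manifold, then there are no real numbers $\rho,\lambda$ and no smooth function $\varphi$ on $M$ with $\mathrm{Ric}+\mathrm{Hess}(\varphi)=(\rho\tau+\lambda)g$, where $\tau$ is the scalar curvature of $(M,g)$.
   Context: A semi-Riemannian manifold $(M,g)$ is a gradient $\rho$-Einstein soliton, for a real number $\rho$, if there are a smooth function $\varphi$ on $M$ and a real number $\lambda$ such that $\mathrm{Ric}+\mathrm{Hess}(\varphi)=(\rho\tau+\lambda)g$, where $\tau$ is the scalar curvature of $(M,g)$. In dimension three, essentially conformally symmetric is understood through the following known characterization: a 3-dimensional pseudo-Riemannian manifold is essentially conformally symmetric if and only if it is a strict Lorentzian Walker manifold locally isometric to $(\mathbb R^3,(t,x,y),g_a)$, where $$g_a=2\,dt\,dy+dx^2+(x^3+a(y)x)\,dy^2$$ for an arbitrary smooth function $a(y)$. *)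

theory Defs
  imports "HOL-Analysis.Analysis"
begin

section \<open>Smooth maps and partial derivatives\<close>

text \<open>These notions are only used for functions on open sets.\<close>

primrec higher_differentiable_on ::
  "nat \<Rightarrow> 'a::real_normed_vector set \<Rightarrow> ('a \<Rightarrow> 'b::real_normed_vector) \<Rightarrow> bool" where
  "higher_differentiable_on 0 S f \<longleftrightarrow> continuous_on S f"
| "higher_differentiable_on (Suc n) S f \<longleftrightarrow>
     (\<forall>x\<in>S. f differentiable (at x)) \<and>
     (\<forall>v. higher_differentiable_on n S (\<lambda>x. frechet_derivative f (at x) v))"

definition smooth_on :: "'a::real_normed_vector set \<Rightarrow> ('a \<Rightarrow> 'b::real_normed_vector) \<Rightarrow> bool" where
  "smooth_on S f \<longleftrightarrow> (\<forall>n. higher_differentiable_on n S f)"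

definition pd :: "'n::finite \<Rightarrow> (real^'n \<Rightarrow> 'b::real_normed_vector) \<Rightarrow> real^'n \<Rightarrow> 'b" where
  "pd i f x = frechet_derivative f (at x) (axis i 1)"


section \<open>Smooth manifolds\<close>

text \<open>
  A chart is a pair of a domain and a coordinate map; the values of the coordinate map outside
  the domain are irrelevant. A smooth structure is a maximal smooth atlas.
\<close>

type_synonym ('a, 'n) chart = "'a set \<times> ('a \<Rightarrow> real^'n)"

definition chart_image :: "('a, 'n::finite) chart \<Rightarrow> (real^'n) set" where
  "chart_image c = snd c ` fst c"

definition chart_inv :: "('a, 'n::finite) chart \<Rightarrow> real^'n \<Rightarrow> 'a" where
  "chart_inv c = inv_into (fst c) (snd c)"

definition is_chart :: "'a topology \<Rightarrow> ('a, 'n::finite) chart \<Rightarrow> bool" where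
  "is_chart X c \<longleftrightarrow>
     openin X (fst c) \<and> open (chart_image c) \<and>
     homeomorphic_map (subtopology X (fst c)) (top_of_set (chart_image c)) (snd c)"

definition coord_change :: "('a, 'n::finite) chart \<Rightarrow> ('a, 'n) chart \<Rightarrow> real^'n \<Rightarrow> real^'n" where
  "coord_change c d = snd d \<circ> chart_inv c"

text \<open>The differential of the change of coordinates from \<open>c\<close> to \<open>d\<close> at the point \<open>p\<close>.\<close>

definition coord_jacobian ::
  "('a, 'n::finite) chart \<Rightarrow> ('a, 'n) chart \<Rightarrow> 'a \<Rightarrow> real^'n \<Rightarrow> real^'n" where
  "coord_jacobian c d p = frechet_derivative (coord_change c d) (at (snd c p))"

definition compatible :: "('a, 'n::finite) chart \<Rightarrow> ('a, 'n) chart \<Rightarrow> bool" where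
  "compatible c d \<longleftrightarrow>
     smooth_on (snd c ` (fst c \<inter> fst d)) (coord_change c d) \<and>
     smooth_on (snd d ` (fst c \<inter> fst d)) (coord_change d c)"

definition smooth_manifold :: "'a topology \<Rightarrow> ('a, 'n::finite) chart set \<Rightarrow> bool" where
  "smooth_manifold X A \<longleftrightarrow>
     topspace X \<noteq> {} \<and> Hausdorff_space X \<and> second_countable X \<and>
     (\<forall>c\<in>A. is_chart X c) \<and>
     (\<Union>c\<in>A. fst c) = topspace X \<and>
     (\<forall>c\<in>A. \<forall>d\<in>A. compatible c d) \<and>
     (\<forall>c. is_chart X c \<and> (\<forall>d\<in>A. compatible c d) \<longrightarrow> c \<in> A)"

definition smooth_function :: "('a, 'n::finite) chart set \<Rightarrow> ('a \<Rightarrow> real) \<Rightarrow> bool" where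
  "smooth_function A f \<longleftrightarrow> (\<forall>c\<in>A. smooth_on (chart_image c) (f \<circ> chart_inv c))"


section \<open>Local formulas\<close>

text \<open>
  Here \<open>G\<close> is the matrix of a metric in coordinates on an open subset of Euclidean space.
  The conventions are
  \<^item> \<open>\<nabla>\<^sub>i \<partial>\<^sub>j = \<Sum>\<^sub>k christoffel G k i j \<partial>\<^sub>k\<close>,
  \<^item> \<open>R(\<partial>\<^sub>i, \<partial>\<^sub>j) \<partial>\<^sub>k = (\<nabla>\<^sub>i \<nabla>\<^sub>j - \<nabla>\<^sub>j \<nabla>\<^sub>i) \<partial>\<^sub>k = \<Sum>\<^sub>l riemann G l k i j \<partial>\<^sub>l\<close>,
  \<^item> \<open>Ric(Y, Z)\<close> is the trace of \<open>W \<mapsto> R(W, Y) Z\<close>, so that round spheres have positive Ricci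
    tensor.
\<close>

definition christoffel ::
  "(real^'n \<Rightarrow> real^'n^'n) \<Rightarrow> 'n::finite \<Rightarrow> 'n \<Rightarrow> 'n \<Rightarrow> real^'n \<Rightarrow> real" where
  "christoffel G k i j x =
     (1/2) * (\<Sum>l\<in>UNIV. matrix_inv (G x) $ k $ l *
       (pd i (\<lambda>z. G z $ j $ l) x + pd j (\<lambda>z. G z $ i $ l) x - pd l (\<lambda>z. G z $ i $ j) x))"

definition riemann ::
  "(real^'n \<Rightarrow> real^'n^'n) \<Rightarrow> 'n::finite \<Rightarrow> 'n \<Rightarrow> 'n \<Rightarrow> 'n \<Rightarrow> real^'n \<Rightarrow> real" where
  "riemann G l k i j x =
     pd i (christoffel G l j k) x - pd j (christoffel G l i k) x +
     (\<Sum>m\<in>UNIV. christoffel G l i m x * christoffel G m j k x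
               - christoffel G l j m x * christoffel G m i k x)"

definition ricci ::
  "(real^'n \<Rightarrow> real^'n^'n) \<Rightarrow> 'n::finite \<Rightarrow> 'n \<Rightarrow> real^'n \<Rightarrow> real" where
  "ricci G j k x = (\<Sum>i\<in>UNIV. riemann G i k i j x)"

definition scalar_curvature :: "(real^'n::finite \<Rightarrow> real^'n^'n) \<Rightarrow> real^'n \<Rightarrow> real" where
  "scalar_curvature G x = (\<Sum>j\<in>UNIV. \<Sum>k\<in>UNIV. matrix_inv (G x) $ j $ k * ricci G j k x)"

definition hessian ::
  "(real^'n \<Rightarrow> real^'n^'n) \<Rightarrow> (real^'n \<Rightarrow> real) \<Rightarrow> 'n::finite \<Rightarrow> 'n \<Rightarrow> real^'n \<Rightarrow> real" where
  "hessian G f i j x = pd i (pd j f) x - (\<Sum>k\<in>UNIV. christoffel G k i j x * pd k f x)"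

definition cov_deriv ::
  "(real^'n \<Rightarrow> real^'n^'n) \<Rightarrow> (real^'n \<Rightarrow> real^'n) \<Rightarrow> 'n::finite \<Rightarrow> 'n \<Rightarrow> real^'n \<Rightarrow> real" where
  "cov_deriv G V i k x = pd i (\<lambda>z. V z $ k) x + (\<Sum>j\<in>UNIV. christoffel G k i j x * V x $ j)"


section \<open>Pseudo-Riemannian manifolds\<close>

text \<open>The maximal dimension of a subspace on which the form with matrix \<open>B\<close> is negative definite.\<close>

definition metric_index :: "real^'n^'n::finite \<Rightarrow> nat" where
  "metric_index B = Max {dim S | S. subspace S \<and> (\<forall>v\<in>S. v \<noteq> 0 \<longrightarrow> v \<bullet> (B *v v) < 0)}"

text \<open>
  A tensor field is given by its components in every chart, subject to the usual transformation
  law under changes of coordinates.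
\<close>

type_synonym ('a, 'n) metric = "('a, 'n) chart \<Rightarrow> real^'n \<Rightarrow> real^'n^'n"

definition pseudo_riemannian_manifold ::
  "'a topology \<Rightarrow> ('a, 'n::finite) chart set \<Rightarrow> ('a, 'n) metric \<Rightarrow> bool" where
  "pseudo_riemannian_manifold X A g \<longleftrightarrow>
     smooth_manifold X A \<and>
     (\<forall>c\<in>A. smooth_on (chart_image c) (g c)) \<and>
     (\<forall>c\<in>A. \<forall>d\<in>A. \<forall>p \<in> fst c \<inter> fst d. \<forall>v w.
        v \<bullet> (g c (snd c p) *v w) =
        coord_jacobian c d p v \<bullet> (g d (snd d p) *v coord_jacobian c d p w)) \<and>
     (\<forall>c\<in>A. \<forall>x\<in>chart_image c. transpose (g c x) = g c x \<and> invertible (g c x)) \<and>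
     (\<exists>\<nu>. \<forall>c\<in>A. \<forall>x\<in>chart_image c. metric_index (g c x) = \<nu>)"

definition lorentzian :: "('a, 'n::finite) chart set \<Rightarrow> ('a, 'n) metric \<Rightarrow> bool" where
  "lorentzian A g \<longleftrightarrow> (\<forall>c\<in>A. \<forall>x\<in>chart_image c. metric_index (g c x) = 1)"

type_synonym ('a, 'n) vfield = "('a, 'n) chart \<Rightarrow> real^'n \<Rightarrow> real^'n"

definition vector_field_on ::
  "('a, 'n::finite) chart set \<Rightarrow> 'a set \<Rightarrow> ('a, 'n) vfield \<Rightarrow> bool" where
  "vector_field_on A W V \<longleftrightarrow>
     (\<forall>c\<in>A. smooth_on (snd c ` (fst c \<inter> W)) (V c)) \<and>
     (\<forall>c\<in>A. \<forall>d\<in>A. \<forall>p \<in> fst c \<inter> fst d \<inter> W.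
        V d (snd d p) = coord_jacobian c d p (V c (snd c p)))"

definition parallel_on ::
  "('a, 'n::finite) chart set \<Rightarrow> ('a, 'n) metric \<Rightarrow> 'a set \<Rightarrow> ('a, 'n) vfield \<Rightarrow> bool" where
  "parallel_on A g W V \<longleftrightarrow>
     (\<forall>c\<in>A. \<forall>x \<in> snd c ` (fst c \<inter> W). \<forall>i k. cov_deriv (g c) (V c) i k x = 0)"

definition null_on ::
  "('a, 'n::finite) chart set \<Rightarrow> ('a, 'n) metric \<Rightarrow> 'a set \<Rightarrow> ('a, 'n) vfield \<Rightarrow> bool" where
  "null_on A g W V \<longleftrightarrow>
     (\<forall>c\<in>A. \<forall>x \<in> snd c ` (fst c \<inter> W). V c x \<noteq> 0 \<and> V c x \<bullet> (g c x *v V c x) = 0)"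

text \<open>
  A strict Lorentzian Walker manifold carries a null line field \<open>D\<close> spanned by parallel null
  vector fields. The spanning fields are only required to exist near each point, since the line
  field need not be globally orientable; a globally defined parallel null vector field is a
  special case. The line field \<open>D\<close> itself is then automatically parallel.
\<close>

definition strict_lorentzian_walker ::
  "'a topology \<Rightarrow> ('a, 'n::finite) chart set \<Rightarrow> ('a, 'n) metric \<Rightarrow> bool" where
  "strict_lorentzian_walker X A g \<longleftrightarrow>
     lorentzian A g \<and>
     (\<exists>D :: ('a, 'n) chart \<Rightarrow> real^'n \<Rightarrow> (real^'n) set.
        \<forall>p\<in>topspace X. \<exists>W V. openin X W \<and> p \<in> W \<and>
          vector_field_on A W V \<and> null_on A g W V \<and> parallel_on A g W V \<and>
          (\<forall>c\<in>A. \<forall>x \<in> snd c ` (fst c \<inter> W). D c x = span {V c x}))"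

text \<open>
  \<open>isometry_onto_open X A g G U \<psi>\<close>: the map \<open>\<psi>\<close> is an isometry from the open set \<open>U\<close> of the
  manifold onto an open subset of Euclidean space with the metric \<open>G\<close>. Compatibility of
  \<open>(U, \<psi>)\<close> with all charts says that \<open>\<psi>\<close> is a diffeomorphism onto its image, and
  \<open>coord_jacobian c (U, \<psi>) p\<close> is the differential of \<open>\<psi>\<close> at \<open>p\<close> expressed in the chart \<open>c\<close>.
\<close>

definition isometry_onto_open ::
  "'a topology \<Rightarrow> ('a, 'n::finite) chart set \<Rightarrow> ('a, 'n) metric \<Rightarrow>
   (real^'n \<Rightarrow> real^'n^'n) \<Rightarrow> 'a set \<Rightarrow> ('a \<Rightarrow> real^'n) \<Rightarrow> bool" where
  "isometry_onto_open X A g G U \<psi> \<longleftrightarrow>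
     is_chart X (U, \<psi>) \<and>
     (\<forall>c\<in>A. compatible (U, \<psi>) c) \<and>
     (\<forall>c\<in>A. \<forall>p \<in> fst c \<inter> U. \<forall>v w.
        v \<bullet> (g c (snd c p) *v w) =
        coord_jacobian c (U, \<psi>) p v \<bullet> (G (\<psi> p) *v coord_jacobian c (U, \<psi>) p w))"

text \<open>
  The metric \<open>2 dt dy + dx\<^sup>2 + (x\<^sup>3 + a(y) x) dy\<^sup>2\<close> on \<open>\<real>\<^sup>3\<close>, with
  \<open>p$1 = t\<close>, \<open>p$2 = x\<close> and \<open>p$3 = y\<close>.
\<close>

definition ecs_model :: "(real \<Rightarrow> real) \<Rightarrow> real^3 \<Rightarrow> real^3^3" where
  "ecs_model a p =
     vector [vector [0, 0, 1],
             vector [0, 1, 0],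
             vector [1, 0, (p$2)^3 + a (p$3) * p$2]]"

text \<open>The function \<open>a\<close> may depend on the point.\<close>

definition essentially_conformally_symmetric_3 ::
  "'a topology \<Rightarrow> ('a, 3) chart set \<Rightarrow> ('a, 3) metric \<Rightarrow> bool" where
  "essentially_conformally_symmetric_3 X A g \<longleftrightarrow>
     strict_lorentzian_walker X A g \<and>
     (\<forall>p\<in>topspace X. \<exists>U \<psi> a. p \<in> U \<and> smooth_on UNIV a \<and>
        isometry_onto_open X A g (ecs_model a) U \<psi>)"


section \<open>Gradient \<open>\<rho>\<close>-Einstein solitons\<close>

definition soliton_equation ::
  "('a, 'n::finite) chart set \<Rightarrow> ('a, 'n) metric \<Rightarrow> ('a \<Rightarrow> real) \<Rightarrow> real \<Rightarrow> real \<Rightarrow> bool" where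
  "soliton_equation A g \<phi> \<rho> \<mu> \<longleftrightarrow>
     (\<forall>c\<in>A. \<forall>x\<in>chart_image c. \<forall>i j.
        ricci (g c) i j x + hessian (g c) (\<phi> \<circ> chart_inv c) i j x =
        (\<rho> * scalar_curvature (g c) x + \<mu>) * g c x $ i $ j)"

definition gradient_rho_einstein_soliton ::
  "('a, 'n::finite) chart set \<Rightarrow> ('a, 'n) metric \<Rightarrow> real \<Rightarrow> bool" where
  "gradient_rho_einstein_soliton A g \<rho> \<longleftrightarrow>
     (\<exists>\<phi> \<mu>. smooth_function A \<phi> \<and> soliton_equation A g \<phi> \<rho> \<mu>)"

end

theory Submission
  imports Defs
begin

text \<open>
  Write \<open>h = x\<^sup>3 + a(y) x\<close> for the coefficient of \<open>dy\<^sup>2\<close>. The model metric has zero scalar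
  curvature and its only nonzero Ricci component is \<open>- h\<^sub>x\<^sub>x / 2 = - 3 x\<close> in the direction \<open>dy\<^sup>2\<close>, so a
  potential \<open>f\<close> satisfies
  \<open>f\<^sub>t\<^sub>x = 0\<close>, \<open>f\<^sub>t\<^sub>y = f\<^sub>x\<^sub>x = \<mu>\<close>, \<open>f\<^sub>x\<^sub>y = h\<^sub>x f\<^sub>t / 2\<close> and
  \<open>f\<^sub>y\<^sub>y = 3 x + h\<^sub>y f\<^sub>t / 2 - h\<^sub>x f\<^sub>x / 2 + \<mu> h\<close>.
  Differentiating the equation for \<open>f\<^sub>x\<^sub>y\<close> in \<open>x\<close> gives \<open>3 x f\<^sub>t = 0\<close>. Hence, where \<open>x \<noteq> 0\<close>, \<open>f\<^sub>t = 0\<close>,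
  \<open>\<mu> = f\<^sub>t\<^sub>y = 0\<close> and \<open>f\<^sub>x\<^sub>x = f\<^sub>x\<^sub>y = 0\<close>. Differentiating the equation for \<open>f\<^sub>y\<^sub>y\<close> in \<open>x\<close> then gives
  \<open>x f\<^sub>x = 1\<close>, which contradicts \<open>f\<^sub>x\<^sub>x = 0\<close>.
\<close>

section \<open>Partial derivatives of smooth functions\<close>

lemma pd_eqI: "(f has_derivative f') (at x) \<Longrightarrow> pd i f x = f' (axis i 1)"
  unfolding pd_def using frechet_derivative_at by metis

lemma pd_const [simp]: "pd i (\<lambda>x. c) = (\<lambda>x. 0)"
  by (rule ext, rule pd_eqI[OF has_derivative_const, THEN trans]) simp

lemma pd_cong_open:
  assumes "open S" "x \<in> S" "\<And>z. z \<in> S \<Longrightarrow> f z = g z"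
  shows "pd i f x = pd i g x"
proof -
  \<comment> \<open>\<open>frechet_derivative\<close> is a choice among the derivatives at the
    point, so functions with the same derivatives there receive the same value, even if there are
    none.\<close>
  have "(f has_derivative D) (at x) \<longleftrightarrow> (g has_derivative D) (at x)" for D
    using assms has_derivative_transform_within_open by (metis (no_types, lifting))
  then show ?thesis
    unfolding pd_def frechet_derivative_def by simp
qed

lemma smooth_on_differentiable: "smooth_on S f \<Longrightarrow> x \<in> S \<Longrightarrow> f differentiable (at x)"
  using higher_differentiable_on.simps(2) unfolding smooth_on_def by blast

lemma smooth_on_pd: "smooth_on S f \<Longrightarrow> smooth_on S (pd i f)"
  using higher_differentiable_on.simps(2) unfolding smooth_on_def pd_def by blast

lemma higher_differentiable_on_subset:
  "higher_differentiable_on n S f \<Longrightarrow> T \<subseteq> S \<Longrightarrow> higher_differentiable_on n T f"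
  by (induction n arbitrary: f) (auto intro: continuous_on_subset)

lemma smooth_on_subset: "smooth_on S f \<Longrightarrow> T \<subseteq> S \<Longrightarrow> smooth_on T f"
  unfolding smooth_on_def using higher_differentiable_on_subset by blast

text \<open>Linear maps on the reals are multiplications by their value at 1. As \<open>a'\<close>
  is smooth again, a second application supplies \<open>a''\<close>.\<close>

lemma smooth_on_real_derivative:
  fixes a :: "real \<Rightarrow> real"
  assumes "smooth_on UNIV a"
  obtains a' where "\<And>y. (a has_real_derivative a' y) (at y)" "smooth_on UNIV a'"
proof
  show "(a has_real_derivative frechet_derivative a (at y) 1) (at y)" for y
  proof -
    have D: "(a has_derivative frechet_derivative a (at y)) (at y)"
      using assms smooth_on_differentiable frechet_derivative_works by blast
    have "frechet_derivative a (at y) = (*) (frechet_derivative a (at y) 1)"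
    proof
      fix h
      show "frechet_derivative a (at y) h = frechet_derivative a (at y) 1 * h"
        using linear_scale[OF has_derivative_linear[OF D], of h 1] by (simp add: mult.commute)
    qed
    then show ?thesis
      unfolding has_field_derivative_def using D by metis
  qed
  show "smooth_on UNIV (\<lambda>y. frechet_derivative a (at y) 1)"
    using assms higher_differentiable_on.simps(2) unfolding smooth_on_def by blast
qed

lemma has_derivative_pd_line:
  assumes "f differentiable (at (x + s *\<^sub>R axis i 1))"
  shows "((\<lambda>s. f (x + s *\<^sub>R axis i 1)) has_vector_derivative pd i f (x + s *\<^sub>R axis i 1)) (at s)"
proof -
  let ?D = "frechet_derivative f (at (x + s *\<^sub>R axis i 1))"
  have D: "(f has_derivative ?D) (at (x + s *\<^sub>R axis i 1))"
    using assms frechet_derivative_works by blast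
  have "((\<lambda>s. x + s *\<^sub>R axis i 1) has_derivative (\<lambda>s. s *\<^sub>R axis i 1)) (at s)"
    by (auto intro!: derivative_eq_intros)
  then have "((\<lambda>s. f (x + s *\<^sub>R axis i 1)) has_derivative (\<lambda>s. ?D (s *\<^sub>R axis i 1))) (at s)"
    using has_derivative_compose D by blast
  then show ?thesis
    unfolding has_vector_derivative_def pd_def
    using linear_scale[OF has_derivative_linear[OF D]] by simp
qed

text \<open>Along the \<open>i\<close>-th coordinate direction \<open>f\<close> is affine with a slope that does not depend on the
  base point, so \<open>pd j f\<close> is constant in that direction; no symmetry of second derivatives is
  needed.\<close>

lemma pd_pd_eq_0_if_pd_const:
  fixes f :: "real^'n::finite \<Rightarrow> real"
  assumes S: "open S" and x: "x \<in> S"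
    and diff: "\<And>z. z \<in> S \<Longrightarrow> f differentiable (at z)"
    and const: "\<And>z. z \<in> S \<Longrightarrow> pd i f z = c"
    and diff2: "pd j f differentiable (at x)"
  shows "pd i (pd j f) x = 0"
proof -
  obtain e where e: "e > 0" "ball x e \<subseteq> S"
    using S x open_contains_ball by blast
  let ?u = "axis i 1 :: real^'n"
  \<comment> \<open>Two displacements below \<open>e/2\<close> stay inside the ball of radius
    \<open>e\<close>, so the whole segment lies in \<open>S\<close>.\<close>
  have shift: "f (z + s *\<^sub>R ?u) = f z + s * c" if z: "dist x z < e/2" and s: "\<bar>s\<bar> < e/2" for z s
  proof -
    have in_S: "z + r *\<^sub>R ?u \<in> S" if "\<bar>r\<bar> < e/2" for r
    proof -
      have "dist z (z + r *\<^sub>R ?u) = \<bar>r\<bar>"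
        by (simp add: dist_norm)
      then have "dist x (z + r *\<^sub>R ?u) < e"
        using z that dist_triangle[of x "z + r *\<^sub>R ?u" z] by linarith
      then show ?thesis
        using e by auto
    qed
    have "((\<lambda>r. f (z + r *\<^sub>R ?u) - r * c) has_real_derivative 0) (at r)" if "\<bar>r\<bar> < e/2" for r
      using has_derivative_pd_line[OF diff[OF in_S[OF that]]] const[OF in_S[OF that]]
      by (auto intro!: derivative_eq_intros simp: has_real_derivative_iff_has_vector_derivative[symmetric])
    then have "\<exists>k. \<forall>r\<in>{-(e/2)<..<e/2}. f (z + r *\<^sub>R ?u) - r * c = k"
      by (intro has_field_derivative_zero_constant)
         (auto intro: has_field_derivative_at_within)
    then obtain k where k: "\<And>r. \<bar>r\<bar> < e/2 \<Longrightarrow> f (z + r *\<^sub>R ?u) - r * c = k"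
      by (metis abs_less_iff greaterThanLessThan_iff minus_less_iff)
    show ?thesis
      using k[of 0] k[OF s] e by simp
  qed
  have pd_shift: "pd j f (x + s *\<^sub>R ?u) = pd j f x" if s: "\<bar>s\<bar> < e/2" for s
  proof -
    have "x + s *\<^sub>R ?u \<in> S"
      using e s by (intro subsetD[OF e(2)]) (auto simp: dist_norm)
    then have "(f has_derivative frechet_derivative f (at (x + s *\<^sub>R ?u))) (at (x + s *\<^sub>R ?u))"
      using diff frechet_derivative_works by blast
    moreover have "((\<lambda>z. z + s *\<^sub>R ?u) has_derivative (\<lambda>h. h)) (at x)"
      by (auto intro!: derivative_eq_intros)
    ultimately have "((\<lambda>z. f (z + s *\<^sub>R ?u)) has_derivative frechet_derivative f (at (x + s *\<^sub>R ?u))) (at x)"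
      using has_derivative_compose by fastforce
    then have "((\<lambda>z. f (z + s *\<^sub>R ?u) - s * c) has_derivative frechet_derivative f (at (x + s *\<^sub>R ?u))) (at x)"
      by (auto intro!: derivative_eq_intros)
    \<comment> \<open>Near \<open>x\<close>, \<open>f\<close> equals its translate by
      \<open>s *\<^sub>R ?u\<close> minus the constant \<open>s * c\<close>; hence its derivative at
      the translated point is also one at \<open>x\<close>.\<close>
    then have "(f has_derivative frechet_derivative f (at (x + s *\<^sub>R ?u))) (at x)"
      by (rule has_derivative_transform_within_open[of _ _ _ _ "ball x (e/2)"])
         (use e shift s in auto)
    then show ?thesis
      using pd_eqI unfolding pd_def by metis
  qed
  have "((\<lambda>s. pd j f (x + s *\<^sub>R ?u)) has_vector_derivative 0) (at 0)"
    by (rule has_vector_derivative_transform_within_open[OF has_vector_derivative_const[of "pd j f x"],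
          of "{-(e/2)<..<e/2}"])
       (use e pd_shift in \<open>auto simp: abs_less_iff minus_less_iff\<close>)
  moreover have "((\<lambda>s. pd j f (x + s *\<^sub>R ?u)) has_vector_derivative pd i (pd j f) x) (at 0)"
    using has_derivative_pd_line[of "pd j f" x 0 i] diff2 by simp
  ultimately show ?thesis
    using vector_derivative_unique_at by metis
qed


section \<open>Locality of curvature\<close>

text \<open>Only derivatives of the metric at the point enter, so agreement on a neighbourhood
  suffices. The chart metric is known to equal the model only on the image of the chart.\<close>

lemma christoffel_cong_open:
  assumes "open S" "x \<in> S" "\<And>z. z \<in> S \<Longrightarrow> G z = H z"
  shows "christoffel G k i j x = christoffel H k i j x"
proof -
  have "pd l (\<lambda>z. G z $ m $ n) x = pd l (\<lambda>z. H z $ m $ n) x" for l m n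
    using assms by (intro pd_cong_open) auto
  then show ?thesis
    using assms by (simp add: christoffel_def)
qed

lemma ricci_cong_open:
  assumes "open S" "x \<in> S" "\<And>z. z \<in> S \<Longrightarrow> G z = H z"
  shows "ricci G j k x = ricci H j k x"
proof -
  have "pd l (christoffel G m n p) x = pd l (christoffel H m n p) x" for l m n p
    using assms christoffel_cong_open[of S _ G H] by (intro pd_cong_open) auto
  then show ?thesis
    using assms christoffel_cong_open[of S x G H] by (simp add: ricci_def riemann_def)
qed

lemma scalar_curvature_cong_open:
  assumes "open S" "x \<in> S" "\<And>z. z \<in> S \<Longrightarrow> G z = H z"
  shows "scalar_curvature G x = scalar_curvature H x"
  using assms ricci_cong_open[of S x G H] by (simp add: scalar_curvature_def)

lemma hessian_cong_open:
  assumes "open S" "x \<in> S" "\<And>z. z \<in> S \<Longrightarrow> G z = H z"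
  shows "hessian G f i j x = hessian H f i j x"
  using assms christoffel_cong_open[of S x G H] by (simp add: hessian_def)


section \<open>Curvature of the model metric\<close>

text \<open>\<open>matrix_inv\<close> is defined by choice; a two-sided inverse is unique, which
  determines the chosen matrix.\<close>

lemma matrix_inv_eqI:
  fixes B C :: "real^'n::finite^'n"
  assumes "B ** C = mat 1" "C ** B = mat 1"
  shows "matrix_inv B = C"
proof -
  have "B ** matrix_inv B = mat 1 \<and> matrix_inv B ** B = mat 1"
    unfolding matrix_inv_def by (rule someI[where x = C]) (use assms in simp)
  then show ?thesis
    using assms(1) by (metis matrix_mul_assoc matrix_mul_lid matrix_mul_rid)
qed

lemma matrix_inv_ecs_model:
  "matrix_inv (ecs_model a p) =
     vector [vector [- ((p$2)^3 + a (p$3) * p$2), 0, 1], vector [0, 1, 0], vector [1, 0, 0]]"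
  by (rule matrix_inv_eqI)
     (simp_all add: ecs_model_def matrix_matrix_mult_def vec_eq_iff forall_3 sum_3 mat_def)

locale ecs_coefficient =
  fixes a a' a'' :: "real \<Rightarrow> real"
  assumes a': "(a has_real_derivative a' y) (at y)"
    and a'': "(a' has_real_derivative a'' y) (at y)"
begin

lemma has_derivative_comp_a:
  "((\<lambda>z::real^3. a (z$3)) has_derivative (\<lambda>h. h$3 * a' (x$3))) (at x)"
  using has_derivative_compose[OF bounded_linear_imp_has_derivative[OF bounded_linear_vec_nth]
      a'[unfolded has_field_derivative_def]]
  by (simp add: mult.commute)

lemma has_derivative_comp_a':
  "((\<lambda>z::real^3. a' (z$3)) has_derivative (\<lambda>h. h$3 * a'' (x$3))) (at x)"
  using has_derivative_compose[OF bounded_linear_imp_has_derivative[OF bounded_linear_vec_nth]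
      a''[unfolded has_field_derivative_def]]
  by (simp add: mult.commute)

lemmas coeff_derivs = has_derivative_comp_a has_derivative_comp_a'
  bounded_linear_imp_has_derivative[OF bounded_linear_vec_nth]

lemma pd_ecs_model:
  "pd l (\<lambda>z. ecs_model a z $ i $ j) x =
     (if i = 3 \<and> j = 3 then
        if l = 2 then 3 * (x$2)^2 + a (x$3) else if l = 3 then a' (x$3) * x$2 else 0
      else 0)"
proof (cases "i = 3 \<and> j = 3")
  case True
  have "((\<lambda>z. (z$2)^3 + a (z$3) * z$2) has_derivative
      (\<lambda>h. (3 * (x$2)^2 + a (x$3)) * h$2 + a' (x$3) * x$2 * h$3)) (at x)"
    by (auto intro!: derivative_eq_intros coeff_derivs simp: algebra_simps)
  from pd_eqI[OF this, where i = l] show ?thesis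
    using True exhaust_3[of l] by (auto simp: ecs_model_def axis_def)
next
  case False
  then have "(\<lambda>z. ecs_model a z $ i $ j) = (\<lambda>z. ecs_model a 0 $ i $ j)"
    using exhaust_3[of i] exhaust_3[of j] by (auto simp: ecs_model_def)
  then show ?thesis
    by (simp only: False if_False pd_const)
qed

text \<open>Stated as an equality of functions so that it can rewrite under \<open>pd\<close> when
  the curvature is computed.\<close>

lemma christoffel_ecs_model:
  "christoffel (ecs_model a) k i j =
     (if k = 1 \<and> (i = 2 \<and> j = 3 \<or> i = 3 \<and> j = 2) then (\<lambda>x. (3 * (x$2)^2 + a (x$3)) / 2)
      else if k = 1 \<and> i = 3 \<and> j = 3 then (\<lambda>x. a' (x$3) * x$2 / 2)
      else if k = 2 \<and> i = 3 \<and> j = 3 then (\<lambda>x. (- (3 * (x$2)^2) - a (x$3)) / 2)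
      else (\<lambda>x. 0))"
  using exhaust_3[of k] exhaust_3[of i] exhaust_3[of j]
  by (elim disjE) (auto simp: christoffel_def matrix_inv_ecs_model sum_3 pd_ecs_model fun_eq_iff)

text \<open>The function is \<open>h\<^sub>x / 2\<close>; the full derivative is recorded for use in
  product rules with derivatives of the potential.\<close>

lemma has_derivative_christoffel_123:
  "((\<lambda>z::real^3. (3 * (z$2)^2 + a (z$3)) / 2) has_derivative
      (\<lambda>h. 3 * x$2 * h$2 + a' (x$3) / 2 * h$3)) (at x)"
  by (auto intro!: derivative_eq_intros coeff_derivs simp: field_simps)

lemma pd_christoffel_ecs_model:
  "pd l (\<lambda>z::real^3. (3 * (z$2)^2 + a (z$3)) / 2) x =
     (if l = 2 then 3 * x$2 else if l = 3 then a' (x$3) / 2 else 0)"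
  "pd l (\<lambda>z::real^3. (- (3 * (z$2)^2) - a (z$3)) / 2) x =
     (if l = 2 then - 3 * x$2 else if l = 3 then - a' (x$3) / 2 else 0)"
  "pd l (\<lambda>z::real^3. a' (z$3) * z$2 / 2) x =
     (if l = 2 then a' (x$3) / 2 else if l = 3 then a'' (x$3) * x$2 / 2 else 0)"
proof -
  show "pd l (\<lambda>z::real^3. (3 * (z$2)^2 + a (z$3)) / 2) x =
      (if l = 2 then 3 * x$2 else if l = 3 then a' (x$3) / 2 else 0)"
    using pd_eqI[OF has_derivative_christoffel_123, where i = l] exhaust_3[of l] by (auto simp: axis_def)
  have "((\<lambda>z::real^3. (- (3 * (z$2)^2) - a (z$3)) / 2) has_derivative
      (\<lambda>h. - (3 * x$2 * h$2 + a' (x$3) / 2 * h$3))) (at x)"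
    by (auto intro!: derivative_eq_intros coeff_derivs simp: field_simps)
  from pd_eqI[OF this, where i = l]
  show "pd l (\<lambda>z::real^3. (- (3 * (z$2)^2) - a (z$3)) / 2) x =
      (if l = 2 then - 3 * x$2 else if l = 3 then - a' (x$3) / 2 else 0)"
    using exhaust_3[of l] by (auto simp: axis_def)
  have "((\<lambda>z::real^3. a' (z$3) * z$2 / 2) has_derivative
      (\<lambda>h. a' (x$3) / 2 * h$2 + a'' (x$3) * x$2 / 2 * h$3)) (at x)"
    by (auto intro!: derivative_eq_intros coeff_derivs simp: field_simps)
  from pd_eqI[OF this, where i = l]
  show "pd l (\<lambda>z::real^3. a' (z$3) * z$2 / 2) x =
      (if l = 2 then a' (x$3) / 2 else if l = 3 then a'' (x$3) * x$2 / 2 else 0)"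
    using exhaust_3[of l] by (auto simp: axis_def)
qed

text \<open>The products of Christoffel symbols and the traces
  \<open>\<Gamma>\<^sup>i\<^sub>i\<^sub>j\<close> contribute nothing; what survives is the
  \<open>x\<close>-derivative of \<open>christoffel (ecs_model a) 2 3 3\<close>.\<close>

lemma ricci_ecs_model:
  "ricci (ecs_model a) j k x = (if j = 3 \<and> k = 3 then - 3 * x$2 else 0)"
  using exhaust_3[of j] exhaust_3[of k]
  by (elim disjE) (simp_all add: ricci_def riemann_def sum_3 christoffel_ecs_model pd_christoffel_ecs_model)

text \<open>The inverse metric vanishes in entry (3,3), the only one where the Ricci tensor can be
  nonzero.\<close>

lemma scalar_curvature_ecs_model: "scalar_curvature (ecs_model a) x = 0"
  by (simp add: scalar_curvature_def sum_3 ricci_ecs_model matrix_inv_ecs_model)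

lemma no_soliton_ecs_model:
  assumes S: "open S" "S \<noteq> {}" and f: "smooth_on S f"
    and sol: "\<And>x i j. x \<in> S \<Longrightarrow>
      ricci (ecs_model a) i j x + hessian (ecs_model a) f i j x =
      (\<rho> * scalar_curvature (ecs_model a) x + \<mu>) * ecs_model a x $ i $ j"
  shows False
proof -
  define T where "T = S \<inter> {x. x$2 \<noteq> 0}"
  have T_open: "open T"
    unfolding T_def using S(1)
    by (intro open_Int open_Collect_neq continuous_intros) auto
  \<comment> \<open>If a point of \<open>S\<close> has \<open>x = 0\<close>, a small move in the
    \<open>x\<close>-direction leaves that plane but not \<open>S\<close>.\<close>
  obtain p where p: "p \<in> T"
  proof -
    obtain q where q: "q \<in> S"
      using S(2) by blast
    obtain e where e: "e > 0" "ball q e \<subseteq> S"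
      using S(1) q open_contains_ball by blast
    have "q + (e/2) *\<^sub>R axis 2 1 \<in> S"
      using e by (intro subsetD[OF e(2)]) (auto simp: dist_norm)
    moreover have "(q + (e/2) *\<^sub>R axis 2 1) $ 2 \<noteq> 0" if "q$2 = 0"
      using that e(1) by simp
    ultimately show thesis
      using that q unfolding T_def by blast
  qed
  have smooth_T: "smooth_on T f"
    using f by (rule smooth_on_subset) (auto simp: T_def)
  have diff: "f differentiable (at x)" "pd i f differentiable (at x)"
    "pd i (pd j f) differentiable (at x)" if "x \<in> T" for x i j
    using smooth_T that by (auto intro!: smooth_on_differentiable[of T] smooth_on_pd)
  note eqs = sol[unfolded hessian_def ricci_ecs_model scalar_curvature_ecs_model
      christoffel_ecs_model sum_3]
  have
    e21: "pd 2 (pd 1 f) x = 0" and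
    e31: "pd 3 (pd 1 f) x = \<mu>" and
    e22: "pd 2 (pd 2 f) x = \<mu>" and
    e23: "pd 2 (pd 3 f) x = (3 * (x$2)^2 + a (x$3)) / 2 * pd 1 f x" and
    e32: "pd 3 (pd 2 f) x = (3 * (x$2)^2 + a (x$3)) / 2 * pd 1 f x" and
    e33: "pd 3 (pd 3 f) x = 3 * x$2 + a' (x$3) * x$2 / 2 * pd 1 f x
        - (3 * (x$2)^2 + a (x$3)) / 2 * pd 2 f x + \<mu> * ((x$2)^3 + a (x$3) * x$2)"
    if "x \<in> T" for x
    using that eqs[of x 2 1] eqs[of x 3 1] eqs[of x 2 2] eqs[of x 2 3] eqs[of x 3 2] eqs[of x 3 3]
    by (simp_all add: T_def ecs_model_def field_simps)
  have pd1: "pd 1 f x = 0" if x: "x \<in> T" for x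
  proof -
    have D: "(pd 1 f has_derivative frechet_derivative (pd 1 f) (at x)) (at x)"
      using diff(2)[OF x] frechet_derivative_works by blast
    have "pd 2 (\<lambda>z. (3 * (z$2)^2 + a (z$3)) / 2 * pd 1 f z) x = 3 * x$2 * pd 1 f x"
      using pd_eqI[OF has_derivative_mult[OF has_derivative_christoffel_123 D], where i = 2] e21[OF x]
      by (simp add: axis_def pd_def)
    moreover have "pd 2 (pd 3 (pd 2 f)) x = pd 2 (\<lambda>z. (3 * (z$2)^2 + a (z$3)) / 2 * pd 1 f z) x"
      using T_open x e32 by (rule pd_cong_open)
    \<comment> \<open>Here \<open>pd 2 f\<close> takes the role of the function: its
      \<open>x\<close>-derivative is the constant \<open>\<mu>\<close>.\<close>
    moreover have "pd 2 (pd 3 (pd 2 f)) x = 0"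
      using T_open x diff e22 by (intro pd_pd_eq_0_if_pd_const[of T]) auto
    ultimately show ?thesis
      using x by (simp add: T_def)
  qed
  have mu: "\<mu> = 0"
    using e31[OF p] pd_cong_open[OF T_open p pd1, where i = 3] by simp
  have pd2: "x$2 * pd 2 f x = 1" if x: "x \<in> T" for x
  proof -
    have D: "(pd 2 f has_derivative frechet_derivative (pd 2 f) (at x)) (at x)"
      using diff(2)[OF x] frechet_derivative_works by blast
    have L: "((\<lambda>z. 3 * z$2) has_derivative (\<lambda>h::real^3. 3 * h$2)) (at x)"
      by (auto intro!: derivative_eq_intros coeff_derivs)
    have "pd 2 (\<lambda>z. 3 * z$2 - (3 * (z$2)^2 + a (z$3)) / 2 * pd 2 f z) x = 3 - 3 * x$2 * pd 2 f x"
      using pd_eqI[OF has_derivative_diff[OF L has_derivative_mult[OF has_derivative_christoffel_123 D]], where i = 2] e22[OF x] mu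
      by (simp add: axis_def pd_def)
    \<comment> \<open>With \<open>f\<^sub>t = \<mu> = 0\<close>, the (3,3) equation reduces to
      \<open>f\<^sub>y\<^sub>y = 3 x - h\<^sub>x f\<^sub>x / 2\<close>.\<close>
    moreover have "pd 2 (pd 3 (pd 3 f)) x =
        pd 2 (\<lambda>z. 3 * z$2 - (3 * (z$2)^2 + a (z$3)) / 2 * pd 2 f z) x"
      using T_open x by (rule pd_cong_open) (simp add: e33 pd1 mu)
    \<comment> \<open>\<open>f\<^sub>t = 0\<close> makes the \<open>x\<close>-derivative of
      \<open>pd 3 f\<close> vanish on \<open>T\<close>.\<close>
    moreover have "pd 2 (pd 3 (pd 3 f)) x = 0"
      using T_open x diff e23 pd1 by (intro pd_pd_eq_0_if_pd_const[where S = T and f = "pd 3 f" and c = 0]) auto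
    ultimately show ?thesis
      by simp
  qed
  have D: "(pd 2 f has_derivative frechet_derivative (pd 2 f) (at p)) (at p)"
    using diff(2)[OF p] frechet_derivative_works by blast
  \<comment> \<open>The derivative of \<open>x f\<^sub>x\<close> is \<open>f\<^sub>x\<close>,
    because \<open>f\<^sub>x\<^sub>x = \<mu> = 0\<close>; constancy of \<open>x f\<^sub>x\<close>
    then forces \<open>f\<^sub>x = 0\<close>, against \<open>x f\<^sub>x = 1\<close>.\<close>
  have "pd 2 (\<lambda>z. z$2 * pd 2 f z) p = pd 2 f p"
    using pd_eqI[OF has_derivative_mult[OF coeff_derivs(3) D], where i = 2] e22[OF p] mu
    by (simp add: axis_def pd_def)
  moreover have "pd 2 (\<lambda>z. z$2 * pd 2 f z) p = 0"
    using pd_cong_open[OF T_open p pd2, where i = 2] by simp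
  ultimately show False
    using pd2[OF p] by simp
qed

end


section \<open>Isometries as charts\<close>

text \<open>The change of coordinates is the identity on the chart image, an open neighbourhood of
  the point, so its differential there is the identity.\<close>

lemma coord_jacobian_self:
  assumes "is_chart X c" "p \<in> fst c"
  shows "coord_jacobian c c p v = v"
proof -
  have op: "open (chart_image c)" "snd c p \<in> chart_image c"
    using assms by (auto simp: is_chart_def chart_image_def)
  have "coord_change c c z = z" if "z \<in> chart_image c" for z
    using that by (auto simp: coord_change_def chart_inv_def chart_image_def f_inv_into_f)
  then have "(coord_change c c has_derivative (\<lambda>h. h)) (at (snd c p))"
    using has_derivative_transform_within_open[OF has_derivative_ident op] by simp
  then show ?thesis
    unfolding coord_jacobian_def using frechet_derivative_at by metis
qed

lemma matrix_eqI_bilinear: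
  fixes B C :: "real^'n::finite^'n"
  assumes "\<And>v w. v \<bullet> (B *v w) = v \<bullet> (C *v w)"
  shows "B = C"
  unfolding matrix_eq using assms vector_eq_ldot by blast

text \<open>By maximality of the atlas the isometry to the model is itself a chart, and in this chart
  the metric is literally the model metric.\<close>

lemma isometry_onto_open_chart:
  assumes M: "smooth_manifold X A" and iso: "isometry_onto_open X A g G U \<psi>"
  shows "(U, \<psi>) \<in> A" and "x \<in> chart_image (U, \<psi>) \<Longrightarrow> g (U, \<psi>) x = G x"
proof -
  show A: "(U, \<psi>) \<in> A"
    using M iso unfolding smooth_manifold_def isometry_onto_open_def by blast
  assume "x \<in> chart_image (U, \<psi>)"
  then obtain p where p: "p \<in> U" "x = \<psi> p"
    by (auto simp: chart_image_def)
  have chart: "is_chart X (U, \<psi>)"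
    using iso by (simp add: isometry_onto_open_def)
  \<comment> \<open>The isometry condition is applied with \<open>(U, \<psi>)\<close> itself as the
    chart; both Jacobians become the identity.\<close>
  have "v \<bullet> (g (U, \<psi>) (\<psi> p) *v w) = v \<bullet> (G (\<psi> p) *v w)" for v w
    using iso A p(1) coord_jacobian_self[OF chart, of p]
    unfolding isometry_onto_open_def by fastforce
  then show "g (U, \<psi>) x = G x"
    using matrix_eqI_bilinear p(2) by blast
qed

theorem theorem8:
  fixes X :: "'a topology"
    and A :: "('a, 3) chart set"
    and g :: "('a, 3) metric"
  assumes "pseudo_riemannian_manifold X A g"
    and "essentially_conformally_symmetric_3 X A g"
  shows "\<not> (\<exists>\<rho>::real. gradient_rho_einstein_soliton A g \<rho>)"
proof
  assume "\<exists>\<rho>::real. gradient_rho_einstein_soliton A g \<rho>"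
  then obtain \<rho> \<phi> \<mu> where \<phi>: "smooth_function A \<phi>" and sol: "soliton_equation A g \<phi> \<rho> \<mu>"
    unfolding gradient_rho_einstein_soliton_def by blast
  have M: "smooth_manifold X A"
    using assms(1) by (simp add: pseudo_riemannian_manifold_def)
  \<comment> \<open>The obstruction is local: one point of the nonempty manifold and a model chart
    around it suffice.\<close>
  then obtain p where "p \<in> topspace X"
    unfolding smooth_manifold_def by blast
  then obtain U \<psi> a where p: "p \<in> U" and a: "smooth_on UNIV a"
    and iso: "isometry_onto_open X A g (ecs_model a) U \<psi>"
    using assms(2) unfolding essentially_conformally_symmetric_3_def by blast
  obtain a' where a': "\<And>y. (a has_real_derivative a' y) (at y)" "smooth_on UNIV a'"
    using smooth_on_real_derivative[OF a] by blast
  obtain a'' where a'': "\<And>y. (a' has_real_derivative a'' y) (at y)"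
    using smooth_on_real_derivative[OF a'(2)] by blast
  interpret ecs_coefficient a a' a''
    using a' a'' by unfold_locales
  let ?c = "(U, \<psi>)" and ?S = "chart_image (U, \<psi>)"
  have S: "open ?S" "?S \<noteq> {}"
    using iso p by (auto simp: isometry_onto_open_def is_chart_def chart_image_def)
  have c: "?c \<in> A" and G: "\<And>x. x \<in> ?S \<Longrightarrow> g ?c x = ecs_model a x"
    using isometry_onto_open_chart[OF M iso] by auto
  have "smooth_on ?S (\<phi> \<circ> chart_inv ?c)"
    using \<phi> c by (simp add: smooth_function_def)
  moreover have "ricci (ecs_model a) i j x + hessian (ecs_model a) (\<phi> \<circ> chart_inv ?c) i j x =
      (\<rho> * scalar_curvature (ecs_model a) x + \<mu>) * ecs_model a x $ i $ j" if "x \<in> ?S" for x i j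
  proof -
    have "ricci (g ?c) i j x + hessian (g ?c) (\<phi> \<circ> chart_inv ?c) i j x =
        (\<rho> * scalar_curvature (g ?c) x + \<mu>) * g ?c x $ i $ j"
      using sol c that unfolding soliton_equation_def by blast
    then show ?thesis
      by (simp only: G[OF that] ricci_cong_open[OF S(1) that G] hessian_cong_open[OF S(1) that G]
          scalar_curvature_cong_open[OF S(1) that G])
  qed
  ultimately show False
    using no_soliton_ecs_model[OF S] by blast
qed

end
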